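(* The automorphism groups of the extended Schrödinger-Virasoro Lie algebra $\widetilde{\mathfrak{sv}}$ and of its universal covering algebra $\widehat{\mathfrak{sv}}$ are isomorphic: $\mathrm{Aut}(\widetilde{\mathfrak{sv}})\cong\mathrm{Aut}(\widehat{\mathfrak{sv}})$.
   Context: The extended Schrödinger-Virasoro Lie algebra $\widetilde{\mathfrak{sv}}$ is the complex Lie algebra with basis $\{L_n, M_n, N_n, Y_{n+\frac12} \mid n\in\mathbb{Z}\}$ and brackets, for all $m,n\in\mathbb{Z}$: $[L_m,L_n]=(n-m)L_{m+n}$, $[M_m,M_n]=0$, $[N_m,N_n]=0$, $[Y_{m+\frac12},Y_{n+\frac12}]=(m-n)M_{m+n+1}$, $[L_m,M_n]=nM_{m+n}$, $[L_m,N_n]=nN_{m+n}$, $[L_m,Y_{n+\frac12}]=\left(n+\frac{1-m}{2}\right)Y_{m+n+\frac12}$, $[N_m,M_n]=2M_{m+n}$, $[N_m,Y_{n+\frac12}]=Y_{m+n+\frac12}$, $[M_m,Y_{n+\frac12}]=0$. Its universal covering algebra (universal central extension) $\widehat{\mathfrak{sv}}$ is the complex Lie algebra with basis $\{L_n,M_n,N_n,Y_{n+\frac12},C_L,C_{LN},C_N\mid n\in\mathbb{Z}\}$ and brackets, for all $m,n\in\mathbb{Z}$: $[L_m,L_n]=(n-m)L_{m+n}+\delta_{m+n,0}\frac{m^3-m}{12}C_L$, $[N_m,N_n]=n\delta_{m+n,0}C_N$, $[L_m,N_n]=nN_{m+n}+\delta_{m+n,0}(m^2-m)C_{LN}$,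 $[M_m,M_n]=0$, $[Y_{m+\frac12},Y_{n+\frac12}]=(m-n)M_{m+n+1}$, $[L_m,M_n]=nM_{m+n}$, $[L_m,Y_{n+\frac12}]=\left(n+\frac{1-m}{2}\right)Y_{m+n+\frac12}$, $[N_m,M_n]=2M_{m+n}$, $[N_m,Y_{n+\frac12}]=Y_{m+n+\frac12}$, $[M_m,Y_{n+\frac12}]=0$, and $C_L,C_{LN},C_N$ central. $\mathrm{Aut}$ denotes the group of Lie algebra automorphisms. *)

theory Defs
  imports Complex_Main "HOL-Algebra.Group" "HOL-Library.Poly_Mapping"
begin

section \<open>Lie algebras and their automorphism groups\<close>

locale lie_algebra = vector_space scale
  for scale :: "'k::field \<Rightarrow> 'g::ab_group_add \<Rightarrow> 'g" +
  fixes bracket :: "'g \<Rightarrow> 'g \<Rightarrow> 'g"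
  assumes bracket_add_left: "bracket (x + y) z = bracket x z + bracket y z"
    and bracket_add_right: "bracket x (y + z) = bracket x y + bracket x z"
    and bracket_scale_left: "bracket (scale c x) y = scale c (bracket x y)"
    and bracket_scale_right: "bracket x (scale c y) = scale c (bracket x y)"
    and bracket_self: "bracket x x = 0"
    and jacobi: "bracket x (bracket y z) + bracket y (bracket z x) + bracket z (bracket x y) = 0"

definition lie_aut :: "('k::field \<Rightarrow> 'g::ab_group_add \<Rightarrow> 'g) \<Rightarrow> ('g \<Rightarrow> 'g \<Rightarrow> 'g) \<Rightarrow> ('g \<Rightarrow> 'g) monoid"
  where "lie_aut scale bracket =
    \<lparr>carrier = {f. Vector_Spaces.linear scale scale f \<and> bij f \<and>
                   (\<forall>x y. f (bracket x y) = bracket (f x) (f y))},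
     monoid.mult = (\<circ>), one = id\<rparr>"

lemma (in lie_algebra) group_lie_aut: "group (lie_aut scale bracket)"
proof (rule groupI)
  fix f g assume "f \<in> carrier (lie_aut scale bracket)" "g \<in> carrier (lie_aut scale bracket)"
  then show "f \<otimes>\<^bsub>lie_aut scale bracket\<^esub> g \<in> carrier (lie_aut scale bracket)"
    by (auto simp: lie_aut_def bij_comp intro: Vector_Spaces.linear_compose)
next
  show "\<one>\<^bsub>lie_aut scale bracket\<^esub> \<in> carrier (lie_aut scale bracket)"
    by (simp add: lie_aut_def linear_id)
next
  fix f assume f: "f \<in> carrier (lie_aut scale bracket)"
  then have lin: "Vector_Spaces.linear scale scale f" and b: "bij f"
    and br: "\<And>x y. f (bracket x y) = bracket (f x) (f y)"
    by (auto simp: lie_aut_def)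
  interpret f: Vector_Spaces.linear scale scale f by (fact lin)
  have fi: "f (inv_into UNIV f x) = x" for x
    using b by (simp add: bij_is_surj surj_f_inv_f)
  have inj: "f x = f y \<longleftrightarrow> x = y" for x y
    using b by (simp add: bij_is_inj inj_eq)
  have "Vector_Spaces.linear scale scale (inv_into UNIV f)"
  proof
    show "inv_into UNIV f (x + y) = inv_into UNIV f x + inv_into UNIV f y" for x y
      using inj[of "inv_into UNIV f (x + y)" "inv_into UNIV f x + inv_into UNIV f y"] by (simp add: fi f.add)
    show "inv_into UNIV f (scale c x) = scale c (inv_into UNIV f x)" for c x
      using inj[of "inv_into UNIV f (scale c x)" "scale c (inv_into UNIV f x)"] by (simp add: fi f.scale)
  qed
  moreover have "inv_into UNIV f (bracket x y) = bracket (inv_into UNIV f x) (inv_into UNIV f y)" for x y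
    using inj[of "inv_into UNIV f (bracket x y)" "bracket (inv_into UNIV f x) (inv_into UNIV f y)"] by (simp add: fi br)
  ultimately have "inv_into UNIV f \<in> carrier (lie_aut scale bracket)"
    using b by (simp add: lie_aut_def bij_imp_bij_inv)
  moreover have "inv_into UNIV f \<circ> f = id"
    using b by (simp add: bij_is_inj)
  ultimately show "\<exists>g \<in> carrier (lie_aut scale bracket).
      g \<otimes>\<^bsub>lie_aut scale bracket\<^esub> f = \<one>\<^bsub>lie_aut scale bracket\<^esub>"
    by (auto simp: lie_aut_def)
qed (auto simp: lie_aut_def)


section \<open>Complex Lie algebras given by a basis and structure constants\<close>

text \<open>The complex vector space with basis indexed by \<open>'i\<close> is the type \<open>'i \<Rightarrow>\<^sub>0 complex\<close> of
  finitely supported coefficient functions; the basis vector of index \<open>i\<close> is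
  \<open>Poly_Mapping.single i 1\<close>, so \<open>Poly_Mapping.single i c\<close> is \<open>c\<close> times that vector.\<close>

definition pm_scale :: "complex \<Rightarrow> ('i \<Rightarrow>\<^sub>0 complex) \<Rightarrow> ('i \<Rightarrow>\<^sub>0 complex)"
  where "pm_scale c x = Poly_Mapping.map ((*) c) x"

definition lin_ext :: "('i \<Rightarrow> ('j \<Rightarrow>\<^sub>0 complex)) \<Rightarrow> ('i \<Rightarrow>\<^sub>0 complex) \<Rightarrow> ('j \<Rightarrow>\<^sub>0 complex)"
  where "lin_ext f x = (\<Sum>i\<in>Poly_Mapping.keys x. pm_scale (Poly_Mapping.lookup x i) (f i))"

definition bilin_ext :: "('i \<Rightarrow> 'i \<Rightarrow> ('i \<Rightarrow>\<^sub>0 complex)) \<Rightarrow>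
    ('i \<Rightarrow>\<^sub>0 complex) \<Rightarrow> ('i \<Rightarrow>\<^sub>0 complex) \<Rightarrow> ('i \<Rightarrow>\<^sub>0 complex)"
  where "bilin_ext b x y = lin_ext (\<lambda>i. lin_ext (b i) y) x"

lemma lookup_pm_scale [simp]: "Poly_Mapping.lookup (pm_scale c x) i = c * Poly_Mapping.lookup x i"
  by (simp add: pm_scale_def Poly_Mapping.map.rep_eq when_def)

lemma pm_scale_single [simp]: "pm_scale c (Poly_Mapping.single i d) = Poly_Mapping.single i (c * d)"
  by (rule poly_mapping_eqI) (simp add: lookup_single when_def)

lemma vector_space_pm_scale: "vector_space pm_scale"
  by unfold_locales (auto intro!: poly_mapping_eqI simp: lookup_add algebra_simps)

interpretation pm: vector_space pm_scale
  by (rule vector_space_pm_scale)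

lemma lin_ext_superset:
  assumes "finite A" "Poly_Mapping.keys x \<subseteq> A"
  shows "lin_ext f x = (\<Sum>i\<in>A. pm_scale (Poly_Mapping.lookup x i) (f i))"
  unfolding lin_ext_def by (rule sum.mono_neutral_left) (use assms in \<open>auto simp: in_keys_iff\<close>)

lemma lin_ext_add [simp]: "lin_ext f (x + y) = lin_ext f x + lin_ext f y"
proof -
  let ?A = "Poly_Mapping.keys x \<union> Poly_Mapping.keys y"
  have "Poly_Mapping.keys (x + y) \<subseteq> ?A" by (rule keys_add)
  then show ?thesis
    by (simp add: lin_ext_superset[of ?A] lookup_add pm.scale_left_distrib sum.distrib)
qed

lemma lin_ext_scale [simp]: "lin_ext f (pm_scale c x) = pm_scale c (lin_ext f x)"
proof -
  have "Poly_Mapping.keys (pm_scale c x) \<subseteq> Poly_Mapping.keys x"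
    by (auto simp: in_keys_iff)
  then show ?thesis
    by (simp add: lin_ext_superset[of "Poly_Mapping.keys x"] pm.scale_sum_right)
qed

lemma lin_ext_single [simp]: "lin_ext f (Poly_Mapping.single i c) = pm_scale c (f i)"
  by (simp add: lin_ext_superset[of "{i}"])

lemma lin_ext_fun_add: "lin_ext (\<lambda>i. f i + g i) x = lin_ext f x + lin_ext g x"
  by (simp add: lin_ext_def pm.scale_right_distrib sum.distrib)

lemma lin_ext_fun_scale: "lin_ext (\<lambda>i. pm_scale c (f i)) x = pm_scale c (lin_ext f x)"
  by (simp add: lin_ext_def pm.scale_sum_right mult.commute)

lemma bilin_ext_add_left: "bilin_ext b (x + y) z = bilin_ext b x z + bilin_ext b y z"
  and bilin_ext_add_right: "bilin_ext b z (x + y) = bilin_ext b z x + bilin_ext b z y"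
  and bilin_ext_scale_left: "bilin_ext b (pm_scale c x) y = pm_scale c (bilin_ext b x y)"
  and bilin_ext_scale_right: "bilin_ext b x (pm_scale c y) = pm_scale c (bilin_ext b x y)"
  by (simp_all add: bilin_ext_def lin_ext_fun_add lin_ext_fun_scale)

lemma bilin_ext_single:
  "bilin_ext b (Poly_Mapping.single i c) (Poly_Mapping.single j d) = pm_scale (c * d) (b i j)"
  by (simp add: bilin_ext_def)

lemma bilin_ext_zero [simp]: "bilin_ext b 0 x = 0" "bilin_ext b x 0 = 0"
  using bilin_ext_scale_left[of b 0 0 x] bilin_ext_scale_right[of b x 0 0] by simp_all

lemma bilin_ext_uminus: "bilin_ext b (- x) y = - bilin_ext b x y"
    "bilin_ext b x (- y) = - bilin_ext b x y"
  using bilin_ext_add_left[of b x "- x" y] bilin_ext_add_right[of b x y "- y"]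
  by (simp_all add: eq_neg_iff_add_eq_0 add.commute)

lemma pm_induct [case_names zero single add]:
  fixes x :: "'i \<Rightarrow>\<^sub>0 complex"
  assumes "P 0" "\<And>i c. P (Poly_Mapping.single i c)" "\<And>x y. P x \<Longrightarrow> P y \<Longrightarrow> P (x + y)"
  shows "P x"
proof -
  have "P (\<Sum>i\<in>A. Poly_Mapping.single i (Poly_Mapping.lookup x i))" if "finite A" for A
    using that by induction (auto intro: assms)
  moreover have "x = (\<Sum>i\<in>Poly_Mapping.keys x. Poly_Mapping.single i (Poly_Mapping.lookup x i))"
    by (rule poly_mapping_eqI)
       (simp add: lookup_sum lookup_single when_def in_keys_iff)
  ultimately show ?thesis by (metis finite_keys)
qed

lemma lie_algebra_bilin_ext:
  assumes anti: "\<And>i j. b j i = - b i j"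
    and jac: "\<And>i j k. lin_ext (b i) (b j k) + lin_ext (b j) (b k i) + lin_ext (b k) (b i j) = 0"
  shows "lie_algebra pm_scale (bilin_ext b)"
proof -
  note bil = bilin_ext_add_left bilin_ext_add_right bilin_ext_scale_left bilin_ext_scale_right
  have skew: "bilin_ext b x y = - bilin_ext b y x" for x y
  proof (induction x rule: pm_induct)
    case (single i c)
    show ?case
    proof (induction y rule: pm_induct)
      case (single j d)
      then show ?case
        using anti[of i j]
        by (auto simp: bilin_ext_single mult.commute intro!: poly_mapping_eqI)
    qed (simp_all add: bil)
  qed (simp_all add: bil)
  have self: "bilin_ext b x x = 0" for x
  proof (rule poly_mapping_eqI)
    fix i
    from skew[of x x] have "Poly_Mapping.lookup (bilin_ext b x x) i = - Poly_Mapping.lookup (bilin_ext b x x) i"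
      by (metis lookup_uminus)
    then show "Poly_Mapping.lookup (bilin_ext b x x) i = Poly_Mapping.lookup 0 i" by simp
  qed
  have one: "bilin_ext b (Poly_Mapping.single i c) y = pm_scale c (lin_ext (b i) y)" for i c y
    by (simp add: bilin_ext_def)
  define J where "J x y z = bilin_ext b x (bilin_ext b y z) + bilin_ext b y (bilin_ext b z x)
      + bilin_ext b z (bilin_ext b x y)" for x y z
  have J_zero: "J 0 y z = 0" "J x 0 z = 0" "J x y 0 = 0" for x y z
    by (simp_all add: J_def)
  have J_add: "J (x + x') y z = J x y z + J x' y z" "J x (y + y') z = J x y z + J x y' z"
    "J x y (z + z') = J x y z + J x y z'" for x x' y y' z z'
    by (simp_all add: J_def bil add_ac)
  have "J x y z = 0" for x y z
  proof (induction x rule: pm_induct)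
    case (single i c)
    show ?case
    proof (induction y rule: pm_induct)
      case (single j d)
      show ?case
      proof (induction z rule: pm_induct)
        case (single k e)
        have "J (Poly_Mapping.single i c) (Poly_Mapping.single j d) (Poly_Mapping.single k e) =
          pm_scale (c * d * e)
            (lin_ext (b i) (b j k) + lin_ext (b j) (b k i) + lin_ext (b k) (b i j))"
          by (simp add: J_def bilin_ext_single bil one pm.scale_right_distrib mult_ac)
        then show ?case by (simp add: jac)
      qed (simp_all add: J_zero J_add)
    qed (simp_all add: J_zero J_add)
  qed (simp_all add: J_zero J_add)
  then have jacobi: "bilin_ext b x (bilin_ext b y z) + bilin_ext b y (bilin_ext b z x)
      + bilin_ext b z (bilin_ext b x y) = 0" for x y z
    by (simp add: J_def)
  show ?thesis
    by unfold_locales (simp_all add: bil self jacobi)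
qed


section \<open>The extended Schroedinger-Virasoro Lie algebra\<close>

text \<open>\<open>SY n\<close> is the index of \<open>Y\<^bsub>n+1/2\<^esub>\<close>.\<close>

datatype sv_index = SL int | SM int | SN int | SY int

fun sv_basis_bracket :: "sv_index \<Rightarrow> sv_index \<Rightarrow> (sv_index \<Rightarrow>\<^sub>0 complex)"
where
  "sv_basis_bracket (SL m) (SL n) = Poly_Mapping.single (SL (m + n)) (of_int (n - m))"
| "sv_basis_bracket (SM m) (SM n) = 0"
| "sv_basis_bracket (SN m) (SN n) = 0"
| "sv_basis_bracket (SY m) (SY n) = Poly_Mapping.single (SM (m + n + 1)) (of_int (m - n))"
| "sv_basis_bracket (SL m) (SM n) = Poly_Mapping.single (SM (m + n)) (of_int n)"
| "sv_basis_bracket (SL m) (SN n) = Poly_Mapping.single (SN (m + n)) (of_int n)"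
| "sv_basis_bracket (SL m) (SY n) = Poly_Mapping.single (SY (m + n)) (of_int n + (1 - of_int m) / 2)"
| "sv_basis_bracket (SN m) (SM n) = Poly_Mapping.single (SM (m + n)) 2"
| "sv_basis_bracket (SN m) (SY n) = Poly_Mapping.single (SY (m + n)) 1"
| "sv_basis_bracket (SM m) (SY n) = 0"
  \<comment> \<open>the remaining brackets, by antisymmetry\<close>
| "sv_basis_bracket (SM n) (SL m) = - Poly_Mapping.single (SM (m + n)) (of_int n)"
| "sv_basis_bracket (SN n) (SL m) = - Poly_Mapping.single (SN (m + n)) (of_int n)"
| "sv_basis_bracket (SY n) (SL m) = - Poly_Mapping.single (SY (m + n)) (of_int n + (1 - of_int m) / 2)"
| "sv_basis_bracket (SM n) (SN m) = - Poly_Mapping.single (SM (m + n)) 2"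
| "sv_basis_bracket (SY n) (SN m) = - Poly_Mapping.single (SY (m + n)) 1"
| "sv_basis_bracket (SY n) (SM m) = 0"

definition sv_bracket :: "(sv_index \<Rightarrow>\<^sub>0 complex) \<Rightarrow> (sv_index \<Rightarrow>\<^sub>0 complex) \<Rightarrow> (sv_index \<Rightarrow>\<^sub>0 complex)"
  where "sv_bracket = bilin_ext sv_basis_bracket"


section \<open>Its universal covering algebra\<close>

text \<open>\<open>HY n\<close> is the index of \<open>Y\<^bsub>n+1/2\<^esub>\<close>.\<close>

datatype svh_index = HL int | HM int | HN int | HY int | CL | CLN | CN

fun svh_basis_bracket :: "svh_index \<Rightarrow> svh_index \<Rightarrow> (svh_index \<Rightarrow>\<^sub>0 complex)"
where
  "svh_basis_bracket (HL m) (HL n) = Poly_Mapping.single (HL (m + n)) (of_int (n - m))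
     + (if m + n = 0 then Poly_Mapping.single CL (of_int (m ^ 3 - m) / 12) else 0)"
| "svh_basis_bracket (HN m) (HN n) =
     (if m + n = 0 then Poly_Mapping.single CN (of_int n) else 0)"
| "svh_basis_bracket (HL m) (HN n) = Poly_Mapping.single (HN (m + n)) (of_int n)
     + (if m + n = 0 then Poly_Mapping.single CLN (of_int (m ^ 2 - m)) else 0)"
| "svh_basis_bracket (HM m) (HM n) = 0"
| "svh_basis_bracket (HY m) (HY n) = Poly_Mapping.single (HM (m + n + 1)) (of_int (m - n))"
| "svh_basis_bracket (HL m) (HM n) = Poly_Mapping.single (HM (m + n)) (of_int n)"
| "svh_basis_bracket (HL m) (HY n) = Poly_Mapping.single (HY (m + n)) (of_int n + (1 - of_int m) / 2)"
| "svh_basis_bracket (HN m) (HM n) = Poly_Mapping.single (HM (m + n)) 2"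
| "svh_basis_bracket (HN m) (HY n) = Poly_Mapping.single (HY (m + n)) 1"
| "svh_basis_bracket (HM m) (HY n) = 0"
  \<comment> \<open>the remaining brackets of the non-central basis vectors, by antisymmetry\<close>
| "svh_basis_bracket (HN n) (HL m) = - (Poly_Mapping.single (HN (m + n)) (of_int n)
     + (if m + n = 0 then Poly_Mapping.single CLN (of_int (m ^ 2 - m)) else 0))"
| "svh_basis_bracket (HM n) (HL m) = - Poly_Mapping.single (HM (m + n)) (of_int n)"
| "svh_basis_bracket (HY n) (HL m) = - Poly_Mapping.single (HY (m + n)) (of_int n + (1 - of_int m) / 2)"
| "svh_basis_bracket (HM n) (HN m) = - Poly_Mapping.single (HM (m + n)) 2"
| "svh_basis_bracket (HY n) (HN m) = - Poly_Mapping.single (HY (m + n)) 1"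
| "svh_basis_bracket (HY n) (HM m) = 0"
  \<comment> \<open>the only cases left have a central argument\<close>
| "svh_basis_bracket _ _ = 0"

definition svh_bracket :: "(svh_index \<Rightarrow>\<^sub>0 complex) \<Rightarrow> (svh_index \<Rightarrow>\<^sub>0 complex) \<Rightarrow> (svh_index \<Rightarrow>\<^sub>0 complex)"
  where "svh_bracket = bilin_ext svh_basis_bracket"


section \<open>Both are Lie algebras\<close>

lemma lin_ext_zero [simp]: "lin_ext f 0 = 0"
  by (simp add: lin_ext_def)

lemma lin_ext_uminus [simp]: "lin_ext f (- x) = - lin_ext f x"
  by (metis add.right_inverse eq_neg_iff_add_eq_0 lin_ext_add lin_ext_zero add.commute)

lemma lin_ext_diff [simp]: "lin_ext f (x - y) = lin_ext f x - lin_ext f y"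
  using lin_ext_add[of f x "- y"] by simp

lemma sv_basis_bracket_skew: "sv_basis_bracket j i = - sv_basis_bracket i j"
  by (cases i; cases j) (auto intro!: poly_mapping_eqI simp: lookup_single when_def algebra_simps)

lemma svh_basis_bracket_skew: "svh_basis_bracket j i = - svh_basis_bracket i j"
  by (cases i; cases j)
     (auto intro!: poly_mapping_eqI
       simp: lookup_single lookup_add when_def add_eq_0_iff2 field_simps power3_eq_cube)

lemma sv_basis_bracket_jacobi:
  "lin_ext (sv_basis_bracket i) (sv_basis_bracket j k) + lin_ext (sv_basis_bracket j) (sv_basis_bracket k i)
     + lin_ext (sv_basis_bracket k) (sv_basis_bracket i j) = 0"
  by (cases i; cases j; cases k)
     (auto intro!: poly_mapping_eqI simp: lookup_single lookup_add when_def field_simps)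

lemma lie_algebra_sv: "lie_algebra pm_scale sv_bracket"
  unfolding sv_bracket_def
  by (rule lie_algebra_bilin_ext[OF sv_basis_bracket_skew sv_basis_bracket_jacobi])

lemma svh_basis_bracket_jacobi:
  "lin_ext (svh_basis_bracket i) (svh_basis_bracket j k) + lin_ext (svh_basis_bracket j) (svh_basis_bracket k i)
     + lin_ext (svh_basis_bracket k) (svh_basis_bracket i j) = 0" (is "?J i j k = 0")
proof -
  have coord: "Poly_Mapping.lookup (?J (f m) (g n) (h p)) t = 0"
    if "f \<in> {HL, HN}" "g \<in> {HL, HN}" "h \<in> {HL, HN}" for f g h m n p t
  proof (cases "p = - m - n")
    case True
    show ?thesis using that unfolding True
      by (auto simp: lookup_single lookup_add lookup_minus lookup_uminus when_def
          add_eq_0_iff field_simps power2_eq_square power3_eq_cube)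
  next
    case False
    then have "m + (n + p) \<noteq> 0" "n + (p + m) \<noteq> 0" "p + (m + n) \<noteq> 0" "m + (p + n) \<noteq> 0"
      "n + (m + p) \<noteq> 0" "p + (n + m) \<noteq> 0" "n + p + m \<noteq> 0" "m + n + p \<noteq> 0" "p + m + n \<noteq> 0"
      "p + n + m \<noteq> 0" "m + p + n \<noteq> 0" "n + m + p \<noteq> 0"
      by auto
    then show ?thesis using that
      by (auto simp: lookup_single lookup_add lookup_minus lookup_uminus when_def field_simps)
  qed
  have LN: "?J (f m) (g n) (h p) = 0"
    if "f \<in> {HL, HN}" "g \<in> {HL, HN}" "h \<in> {HL, HN}" for f g h m n p
    using coord[OF that] by (intro poly_mapping_eqI) simp
  show ?thesis
  proof (cases "\<exists>f\<in>{HL, HN}. \<exists>g\<in>{HL, HN}. \<exists>h\<in>{HL, HN}. \<exists>m n p. i = f m \<and> j = g n \<and> k = h p")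
    case True
    then obtain f m g n h p where fgh: "f \<in> {HL, HN}" "g \<in> {HL, HN}" "h \<in> {HL, HN}"
      and "i = f m" "j = g n" "k = h p"
      by (elim bexE exE conjE)
    then show ?thesis using LN[OF fgh, of m n p] by (simp only:)
  next
    case False
    show ?thesis
    proof (rule poly_mapping_eqI)
      fix t
      show "Poly_Mapping.lookup (?J i j k) t = Poly_Mapping.lookup 0 t"
        using False
        by (cases i; cases j; cases k)
           (auto simp: lookup_single lookup_add lookup_minus lookup_uminus when_def field_simps)
    qed
  qed
qed

lemma lie_algebra_svh: "lie_algebra pm_scale svh_bracket"
  unfolding svh_bracket_def
  by (rule lie_algebra_bilin_ext[OF svh_basis_bracket_skew svh_basis_bracket_jacobi])

end

theory Submission
  imports Defs
begin

text \<open>The algebra \<open>svh\<close> is a central extension of \<open>sv\<close>. It is perfect, so an automorphism of \<open>sv\<close>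
  has at most one lift to \<open>svh\<close>; and \<open>sv\<close> has trivial centre, so the kernel of \<open>svh \<rightarrow> sv\<close> is the
  centre of \<open>svh\<close> and every automorphism of \<open>svh\<close> descends. Lifts exist because every 2-cocycle of
  \<open>sv\<close> factors through the bracket of \<open>svh\<close>. To see this, subtract a suitable linear function of the
  bracket of \<open>svh\<close> so that the cocycle vanishes on a few pairs of basis vectors. As the eigenvalues of
  \<open>ad N\<^sub>0\<close> on \<open>L, N, Y, M\<close> are \<open>0, 0, 1, 2\<close>, the cocycle lives on the \<open>L\<^sub>m\<close> and \<open>N\<^sub>m\<close>, by
  \<open>ad L\<^sub>0\<close> it lives in total degree zero, and there it vanishes by one-step recursions.\<close>

section \<open>Linear maps and induction over basis vectors\<close>

abbreviation basis :: "'i \<Rightarrow> ('i \<Rightarrow>\<^sub>0 complex)"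
  where "basis i \<equiv> Poly_Mapping.single i 1"

abbreviation (input) pm_linear :: "(('i \<Rightarrow>\<^sub>0 complex) \<Rightarrow> ('j \<Rightarrow>\<^sub>0 complex)) \<Rightarrow> bool"
  where "pm_linear \<equiv> Vector_Spaces.linear pm_scale pm_scale"

lemma pm_linearI:
  assumes "\<And>x y. f (x + y) = f x + f y" "\<And>c x. f (pm_scale c x) = pm_scale c (f x)"
  shows "pm_linear f"
  by unfold_locales (use assms in auto)

lemma pm_linearD:
  assumes "pm_linear f"
  shows "f (x + y) = f x + f y" "f (pm_scale c x) = pm_scale c (f x)" "f 0 = 0" "f (x - y) = f x - f y"
proof -
  interpret Vector_Spaces.linear pm_scale pm_scale f by fact
  show "f (x + y) = f x + f y" "f (pm_scale c x) = pm_scale c (f x)" "f 0 = 0" "f (x - y) = f x - f y"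
    by (simp_all add: add scale diff)
qed

text \<open>Coefficients are split off into \<open>scale\<close>, so that the base case concerns
  basis vectors alone, where a bracket is a structure constant.\<close>

lemma pm_basis_induct [case_names basis add scale]:
  assumes "\<And>i. P (basis i)" "\<And>x y. P x \<Longrightarrow> P y \<Longrightarrow> P (x + y)" "\<And>c x. P x \<Longrightarrow> P (pm_scale c x)"
  shows "P x"
proof (induction x rule: pm_induct)
  case zero
  show ?case using assms(3)[OF assms(1), of 0 undefined] by simp
next
  case (single i c)
  show ?case using assms(3)[OF assms(1), of c i] by simp
qed (rule assms(2))

lemmas sv_bracket_bilin =
  bilin_ext_add_left[of sv_basis_bracket, folded sv_bracket_def]
  bilin_ext_add_right[of sv_basis_bracket, folded sv_bracket_def]
  bilin_ext_scale_left[of sv_basis_bracket, folded sv_bracket_def]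
  bilin_ext_scale_right[of sv_basis_bracket, folded sv_bracket_def]

lemmas svh_bracket_bilin =
  bilin_ext_add_left[of svh_basis_bracket, folded svh_bracket_def]
  bilin_ext_add_right[of svh_basis_bracket, folded svh_bracket_def]
  bilin_ext_scale_left[of svh_basis_bracket, folded svh_bracket_def]
  bilin_ext_scale_right[of svh_basis_bracket, folded svh_bracket_def]

lemma sv_bracket_basis [simp]: "sv_bracket (basis i) (basis j) = sv_basis_bracket i j"
  by (simp add: sv_bracket_def bilin_ext_single)

lemma svh_bracket_basis [simp]: "svh_bracket (basis i) (basis j) = svh_basis_bracket i j"
  by (simp add: svh_bracket_def bilin_ext_single)

interpretation svh: lie_algebra pm_scale svh_bracket
  by (rule lie_algebra_svh)


section \<open>The central extension\<close>

fun svh_of_sv_index :: "sv_index \<Rightarrow> svh_index" where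
  "svh_of_sv_index (SL n) = HL n"
| "svh_of_sv_index (SM n) = HM n"
| "svh_of_sv_index (SN n) = HN n"
| "svh_of_sv_index (SY n) = HY n"

fun svh_basis_proj :: "svh_index \<Rightarrow> (sv_index \<Rightarrow>\<^sub>0 complex)" where
  "svh_basis_proj (HL n) = basis (SL n)"
| "svh_basis_proj (HM n) = basis (SM n)"
| "svh_basis_proj (HN n) = basis (SN n)"
| "svh_basis_proj (HY n) = basis (SY n)"
| "svh_basis_proj _ = 0"

definition svh_proj :: "(svh_index \<Rightarrow>\<^sub>0 complex) \<Rightarrow> (sv_index \<Rightarrow>\<^sub>0 complex)"
  where "svh_proj = lin_ext svh_basis_proj"

text \<open>A linear section of \<open>svh_proj\<close>, but not a homomorphism: brackets in
  \<open>svh\<close> carry central terms.\<close>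

definition svh_incl :: "(sv_index \<Rightarrow>\<^sub>0 complex) \<Rightarrow> (svh_index \<Rightarrow>\<^sub>0 complex)"
  where "svh_incl = lin_ext (\<lambda>i. basis (svh_of_sv_index i))"

lemma svh_proj_linear [simp]:
  "svh_proj (x + y) = svh_proj x + svh_proj y" "svh_proj (pm_scale c x) = pm_scale c (svh_proj x)"
  "svh_proj (x - y) = svh_proj x - svh_proj y" "svh_proj (- x) = - svh_proj x" "svh_proj 0 = 0"
  "svh_proj (Poly_Mapping.single i c) = pm_scale c (svh_basis_proj i)"
  by (simp_all add: svh_proj_def)

lemma svh_incl_linear [simp]:
  "svh_incl (x + y) = svh_incl x + svh_incl y" "svh_incl (pm_scale c x) = pm_scale c (svh_incl x)"
  "svh_incl 0 = 0" "svh_incl (Poly_Mapping.single j c) = Poly_Mapping.single (svh_of_sv_index j) c"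
  by (simp_all add: svh_incl_def)

lemma svh_proj_incl [simp]: "svh_proj (svh_incl x) = x"
proof (induction x rule: pm_basis_induct)
  case (basis i)
  then show ?case by (cases i) auto
qed auto

lemma svh_decompose:
  "x = svh_incl (svh_proj x) + pm_scale (Poly_Mapping.lookup x CL) (basis CL)
     + pm_scale (Poly_Mapping.lookup x CLN) (basis CLN) + pm_scale (Poly_Mapping.lookup x CN) (basis CN)"
proof (induction x rule: pm_basis_induct)
  case (basis i)
  then show ?case by (cases i) (auto simp: lookup_single when_def)
next
  case (add x y)
  show ?case
    by (rule trans[OF arg_cong2[where f = "(+)", OF add]]) (simp add: lookup_add single_add add_ac)
next
  case (scale c x)
  then show ?case by (metis (no_types, lifting) lookup_pm_scale pm.scale_right_distrib pm.scale_scale svh_incl_linear(2) svh_proj_linear(2))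
qed

text \<open>The kernel of \<open>svh_proj\<close> is spanned by central vectors, so the bracket of
  \<open>svh\<close> amounts to a bilinear map on \<open>sv\<close> with values in
  \<open>svh\<close>.\<close>

lemma svh_bracket_proj:
  "svh_bracket x y = svh_bracket (svh_incl (svh_proj x)) (svh_incl (svh_proj y))"
proof (induction x rule: pm_basis_induct)
  case (basis i)
  show ?case
  proof (induction y rule: pm_basis_induct)
    case (basis j)
    show ?case by (cases i; cases j) (auto simp: svh_bracket_def bilin_ext_single)
  qed (simp_all add: svh_bracket_bilin)
qed (simp_all add: svh_bracket_bilin)

lemma svh_bracket_cong:
  assumes "svh_proj x = svh_proj x'" "svh_proj y = svh_proj y'"
  shows "svh_bracket x y = svh_bracket x' y'"
  using assms svh_bracket_proj by metis

lemma svh_proj_bracket: "svh_proj (svh_bracket x y) = sv_bracket (svh_proj x) (svh_proj y)"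
proof (induction x rule: pm_basis_induct)
  case (basis i)
  show ?case
  proof (induction y rule: pm_basis_induct)
    case (basis j)
    show ?case by (cases i; cases j) (auto simp: sv_bracket_def bilin_ext_single)
  qed (simp_all add: svh_bracket_bilin sv_bracket_bilin)
qed (simp_all add: svh_bracket_bilin sv_bracket_bilin)

section \<open>Perfectness and uniqueness of lifts\<close>

text \<open>Perfectness as an induction rule. For nonzero \<open>n\<close>, \<open>HL n\<close> and
  \<open>HN n\<close> are eigenvectors of ad \<open>HL 0\<close>, and all \<open>HM n\<close> and
  \<open>HY n\<close> are eigenvectors of ad \<open>HN 0\<close>, with nonzero eigenvalues.\<close>

lemma svh_perfect [case_names add scale bracket]:
  assumes add: "\<And>x y. P x \<Longrightarrow> P y \<Longrightarrow> P (x + y)" and scale: "\<And>c x. P x \<Longrightarrow> P (pm_scale c x)"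
    and bracket: "\<And>x y. P (svh_bracket x y)"
  shows "P x"
proof (induction x rule: pm_basis_induct)
  case (basis i)
  have P_eq: "P x" if "pm_scale c (svh_bracket (basis i) (basis j)) = x" for c i j x
    using that scale bracket by blast
  \<comment> \<open>In degree zero the first index is taken to be 1, where the central coefficients
    \<open>m ^ 3 - m\<close> and \<open>m ^ 2 - m\<close> vanish.\<close>
  have L0: "P (basis (HL 0))"
    by (rule P_eq[where i = "HL 1" and j = "HL (-1)" and c = "-1/2"]) simp
  have N0: "P (basis (HN 0))"
    by (rule P_eq[where i = "HL 1" and j = "HN (-1)" and c = "-1"]) simp
  show ?case
  proof (cases i)
    case (HL n)
    then show ?thesis
      by (cases "n = 0") (use L0 in \<open>auto intro: P_eq[where i = "HL 0" and j = "HL n" and c = "1 / of_int n"]\<close>)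
  next
    case (HN n)
    then show ?thesis
      by (cases "n = 0") (use N0 in \<open>auto intro: P_eq[where i = "HL 0" and j = "HN n" and c = "1 / of_int n"]\<close>)
  next
    case (HM n)
    then show ?thesis by (auto intro: P_eq[where i = "HN 0" and j = "HM n" and c = "1/2"])
  next
    case (HY n)
    then show ?thesis by (auto intro: P_eq[where i = "HN 0" and j = "HY n" and c = 1])
  next
    case CN
    then show ?thesis by (auto intro: P_eq[where i = "HN 1" and j = "HN (-1)" and c = "-1"])
  next
    \<comment> \<open>The central coefficient is \<open>1/2\<close> at \<open>m = 2\<close> here,
      and 2 at \<open>m = -1\<close> for \<open>CLN\<close>. \<open>L0\<close> and \<open>N0\<close>
      cancel the rest of the bracket.\<close>
    case CL
    have "P (pm_scale 2 (svh_bracket (basis (HL 2)) (basis (HL (-2)))) + pm_scale 8 (basis (HL 0)))"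
      by (intro add scale L0 bracket)
    then show ?thesis using CL by (simp add: pm.scale_right_distrib add_ac flip: single_add)
  next
    case CLN
    have "P (pm_scale (1/2) (svh_bracket (basis (HL (-1))) (basis (HN 1)) + pm_scale (-1) (basis (HN 0))))"
      by (intro add scale N0 bracket)
    then show ?thesis using CLN by (simp add: pm.scale_right_distrib add_ac flip: single_add)
  qed
qed (use add scale in auto)

text \<open>On a bracket both maps are brackets of images, which see only the projections;
  perfectness extends the equality to every vector.\<close>

lemma svh_hom_unique:
  assumes f: "pm_linear f" "\<And>x y. f (svh_bracket x y) = svh_bracket (f x) (f y)"
    and g: "pm_linear g" "\<And>x y. g (svh_bracket x y) = svh_bracket (g x) (g y)"
    and eq: "\<And>x. svh_proj (f x) = svh_proj (g x)"
  shows "f = g"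
proof
  fix x show "f x = g x"
  proof (induction x rule: svh_perfect)
    case (bracket x y)
    show ?case by (simp add: f(2) g(2) svh_bracket_cong[OF eq eq])
  qed (simp_all add: pm_linearD[OF f(1)] pm_linearD[OF g(1)])
qed

text \<open>Three probes read off every coordinate of \<open>z\<close>. The \<open>SL\<close>
  coordinates come from \<open>SN 1\<close>, as \<open>SL n\<close> commutes with
  \<open>SM 0\<close> and \<open>SN 0\<close>.\<close>

lemma sv_bracket_coordinates:
  "Poly_Mapping.lookup (sv_bracket z (basis (SM 0))) (SM n) = 2 * Poly_Mapping.lookup z (SN n)"
  "Poly_Mapping.lookup (sv_bracket z (basis (SN 1))) (SN (n + 1)) = Poly_Mapping.lookup z (SL n)"
  "Poly_Mapping.lookup (sv_bracket z (basis (SN 0))) (SM n) = - 2 * Poly_Mapping.lookup z (SM n)"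
  "Poly_Mapping.lookup (sv_bracket z (basis (SN 0))) (SY n) = - Poly_Mapping.lookup z (SY n)"
proof (induction z rule: pm_basis_induct)
  case (basis i)
  { case 1 show ?case by (cases i) (auto simp: lookup_single when_def) }
  { case 2 show ?case by (cases i) (auto simp: lookup_single when_def) }
  { case 3 show ?case by (cases i) (auto simp: lookup_single when_def) }
  { case 4 show ?case by (cases i) (auto simp: lookup_single when_def) }
qed (simp_all add: sv_bracket_bilin lookup_add algebra_simps)

lemma sv_centerless:
  assumes "\<And>y. sv_bracket z y = 0"
  shows "z = 0"
proof (rule poly_mapping_eqI)
  fix i
  show "Poly_Mapping.lookup z i = Poly_Mapping.lookup 0 i"
    using sv_bracket_coordinates[of z] by (cases i) (auto simp: assms)
qed


section \<open>Two-cocycles\<close>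

locale sv_cocycle =
  fixes \<beta> :: "(sv_index \<Rightarrow>\<^sub>0 complex) \<Rightarrow> (sv_index \<Rightarrow>\<^sub>0 complex) \<Rightarrow> complex"
  assumes add: "\<beta> (x + y) z = \<beta> x z + \<beta> y z" "\<beta> z (x + y) = \<beta> z x + \<beta> z y"
    and scale: "\<beta> (pm_scale c x) y = c * \<beta> x y" "\<beta> x (pm_scale c y) = c * \<beta> x y"
    and skew: "\<beta> y x = - \<beta> x y"
    and cocycle: "\<beta> (sv_bracket x y) z + \<beta> (sv_bracket y z) x + \<beta> (sv_bracket z x) y = 0"
begin

definition val :: "sv_index \<Rightarrow> sv_index \<Rightarrow> complex"
  where "val i j = \<beta> (basis i) (basis j)"

lemma single: "\<beta> (Poly_Mapping.single i c) (basis j) = c * val i j"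
  using scale(1)[of c "basis i"] by (simp add: val_def)

lemma zero: "\<beta> 0 x = 0"
  using scale(1)[of 0 0] by simp

lemma uminus: "\<beta> (- x) y = - \<beta> x y"
  using add(1)[of x "- x"] zero by (simp add: eq_neg_iff_add_eq_0 add.commute)

lemma val_skew: "val j i = - val i j"
  by (simp add: val_def skew[of "basis j"])

lemma cocycle_basis:
  "\<beta> (sv_basis_bracket i j) (basis k) + \<beta> (sv_basis_bracket j k) (basis i)
    + \<beta> (sv_basis_bracket k i) (basis j) = 0"
  using cocycle[of "basis i" "basis j" "basis k"] by simp

lemmas evaluate = single zero uminus

end

text \<open>The values \<open>\<beta>(L\<^sub>n, L\<^sub>-\<^sub>n)\<close> and \<open>\<beta>(L\<^sub>n, N\<^sub>-\<^sub>n)\<close> of a cocycle normalized as below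
  satisfy the next two recursions.\<close>

lemma recursion_LL:
  fixes c :: "int \<Rightarrow> complex"
  assumes rec: "\<And>n. of_int (n - 1) * c (n + 1) = of_int (n + 2) * c n"
    and odd: "\<And>n. c (- n) = - c n" and zero: "c 1 = 0" "c 2 = 0"
  shows "c n = 0"
proof -
  \<comment> \<open>At \<open>n = 1\<close> the factor of \<open>c (n + 1)\<close> is zero, so
    \<open>c 2\<close> is not determined by \<open>c 1\<close> and the induction starts at
    2.\<close>
  have pos: "c (int k + 2) = 0" for k
  proof (induction k)
    case (Suc k)
    then show ?case
      using rec[of "int k + 2"] of_nat_neq_0[of k, where ?'a = complex, unfolded of_nat_Suc] by (simp add: add_ac)
  qed (use zero in simp)
  have nonneg: "c n = 0" if "n \<ge> 0" for n
    using that pos[of "nat (n - 2)"] zero odd[of 0] by (cases "n = 0 \<or> n = 1") auto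
  show ?thesis using nonneg[of n] nonneg[of "- n"] odd[of n] by (cases "n \<ge> 0") auto
qed

lemma recursion_LN:
  fixes d :: "int \<Rightarrow> complex"
  assumes rec: "\<And>m n. of_int (n - m) * d (m + n) = of_int (m + n) * (d n - d m)"
    and zero: "d 1 = 0" "d (-1) = 0"
  shows "d n = 0"
proof -
  have d0: "d 0 = 0" using rec[of 0 1] rec[of 1 "-1"] by simp
  \<comment> \<open>The pair \<open>m = n = 1\<close> only says \<open>0 = 0\<close>, so
    \<open>d 2\<close> is reached through \<open>d (-1)\<close>.\<close>
  have d2: "d 2 = 0" using rec[of 2 "-1"] zero by simp
  have pos: "d (int k + 2) = 0" for k
  proof (induction k)
    case (Suc k)
    then show ?case
      using rec[of "int k + 2" 1] zero of_nat_neq_0[of k, where ?'a = complex, unfolded of_nat_Suc]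
      by (simp add: add_ac)
  qed (use d2 in simp)
  have neg: "d (- int k - 1) = 0" for k
  proof (induction k)
    case (Suc k)
    have "of_nat (Suc k) * d (- int k - 2) = 0"
      using rec[of "- int k - 2" 1] zero Suc[unfolded minus_diff_commute[of "int k"]]
      by (simp add: algebra_simps)
    then have "d (- int k - 2) = 0" by (simp del: of_nat_Suc)
    then show ?case by (simp add: algebra_simps)
  qed (use zero in simp)
  show ?thesis
    using pos[of "nat (n - 2)"] neg[of "nat (- n - 1)"] zero d0
    by (cases "n = 0 \<or> n = 1"; cases "n > 0") auto
qed

text \<open>The conditions match the basis of \<open>svh\<close>, in this order:
  \<open>HM n\<close>, \<open>HY n\<close>, \<open>HL n\<close> and \<open>HN n\<close> for nonzero
  \<open>n\<close>; then \<open>HL 0\<close> with \<open>CL\<close>, \<open>HN 0\<close> with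
  \<open>CLN\<close>, and \<open>CN\<close>. Hence a linear function on \<open>svh\<close> has just
  the freedom to achieve them.\<close>

lemma (in sv_cocycle) normalized_vanishes_on_basis:
  assumes "\<And>n. \<beta> (basis (SN 0)) (basis (SM n)) = 0"
    and "\<And>n. \<beta> (basis (SN 0)) (basis (SY n)) = 0"
    and "\<And>n. n \<noteq> 0 \<Longrightarrow> \<beta> (basis (SL 0)) (basis (SL n)) = 0"
    and "\<And>n. n \<noteq> 0 \<Longrightarrow> \<beta> (basis (SL 0)) (basis (SN n)) = 0"
    and "\<beta> (basis (SL 1)) (basis (SL (-1))) = 0" "\<beta> (basis (SL 2)) (basis (SL (-2))) = 0"
    and "\<beta> (basis (SL 1)) (basis (SN (-1))) = 0" "\<beta> (basis (SL (-1))) (basis (SN 1)) = 0"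
    and "\<beta> (basis (SN 1)) (basis (SN (-1))) = 0"
  shows "\<beta> (basis i) (basis j) = 0"
proof -
  note normalized = assms[folded val_def]
  have orient: "val (SN n) (SL m) = - val (SL m) (SN n)" "val (SM n) (SL m) = - val (SL m) (SM n)"
    "val (SY n) (SL m) = - val (SL m) (SY n)" "val (SM n) (SN m) = - val (SN m) (SM n)"
    "val (SY n) (SN m) = - val (SN m) (SY n)" "val (SY n) (SM m) = - val (SM m) (SY n)" for m n
    by (rule val_skew)+
  note evaluate = evaluate orient
  have L0L: "val (SL 0) (SL n) = 0" for n
    using normalized(3)[of n] val_skew[of "SL 0" "SL 0"] by (cases "n = 0") simp_all
  \<comment> \<open>From here to \<open>YY\<close>, the identity with \<open>SN 0\<close> multiplies
    the value, up to sign, by the sum of the two weights, which is positive. The term paired with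
    \<open>SN 0\<close> vanishes by normalization or because the bracket is zero.\<close>
  have LM: "val (SL m) (SM n) = 0" for m n
    using cocycle_basis[of "SN 0" "SL m" "SM n"] normalized(1) by (simp add: evaluate)
  have LY: "val (SL m) (SY n) = 0" for m n
    using cocycle_basis[of "SN 0" "SL m" "SY n"] normalized(2) by (simp add: evaluate)
  have NM': "val (SN m) (SM n) = 0" for m n
    using cocycle_basis[of "SN 0" "SN m" "SM n"] normalized(1) by (simp add: evaluate)
  have NY': "val (SN m) (SY n) = 0" for m n
    using cocycle_basis[of "SN 0" "SN m" "SY n"] normalized(2) by (simp add: evaluate)
  have MM: "val (SM m) (SM n) = 0" for m n
    using cocycle_basis[of "SN 0" "SM m" "SM n"] val_skew[of "SM n" "SM m"]
    by (simp add: evaluate)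
  have MY: "val (SM m) (SY n) = 0" for m n
    using cocycle_basis[of "SN 0" "SM m" "SY n"] by (simp add: evaluate)
  have YY: "val (SY m) (SY n) = 0" for m n
    using cocycle_basis[of "SN 0" "SY m" "SY n"] val_skew[of "SY n" "SY m"] normalized(1)
    by (simp add: evaluate)
  \<comment> \<open>With \<open>SL 0\<close> in place of \<open>SN 0\<close> the factor is the total
    degree \<open>m + n\<close>, so only degree zero remains.\<close>
  have nz: "complex_of_int m + of_int n \<noteq> 0" if "m + n \<noteq> 0" for m n
    using that by (metis of_int_add of_int_eq_0_iff)
  have LL': "val (SL m) (SL n) = 0" if "m + n \<noteq> 0" for m n
  proof -
    have "(of_int m + of_int n) * val (SL m) (SL n) = 0"
      using cocycle_basis[of "SL 0" "SL m" "SL n"] L0L[of "m + n"]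
        val_skew[of "SL n" "SL m"] val_skew[of "SL (m + n)" "SL 0"]
      by (simp add: evaluate algebra_simps)
    then show ?thesis using nz[OF that] by simp
  qed
  have LN': "val (SL m) (SN n) = 0" if "m + n \<noteq> 0" for m n
  proof -
    have "(of_int m + of_int n) * val (SL m) (SN n) = 0"
      using cocycle_basis[of "SL 0" "SL m" "SN n"] normalized(4)[OF that] by (simp add: evaluate algebra_simps)
    then show ?thesis using nz[OF that] by simp
  qed
  have NN': "val (SN m) (SN n) = 0" if "m + n \<noteq> 0" for m n
  proof -
    have "(of_int m + of_int n) * val (SN m) (SN n) = 0"
      using cocycle_basis[of "SL 0" "SN m" "SN n"] val_skew[of "SN n" "SN m"]
      by (simp add: evaluate algebra_simps)
    then show ?thesis using nz[OF that] by simp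
  qed
  have LL0: "val (SL n) (SL (- n)) = 0" for n
  proof (rule recursion_LL[where c = "\<lambda>n. val (SL n) (SL (- n))"])
    fix n
    show "val (SL (- n)) (SL (- (- n))) = - val (SL n) (SL (- n))"
      using val_skew[of "SL (- n)" "SL n"] by simp
    \<comment> \<open>One term of the identity is a multiple of \<open>val (SL (-1)) (SL 1)\<close>,
      zero by normalization; the other two form the recursion.\<close>
    show "of_int (n - 1) * val (SL (n + 1)) (SL (- (n + 1))) = of_int (n + 2) * val (SL n) (SL (- n))"
      using cocycle_basis[of "SL 1" "SL n" "SL (- (n + 1))"] normalized(5,6)
        val_skew[of "SL (-1)" "SL 1"] val_skew[of "SL (- n)" "SL n"]
      by (simp add: evaluate algebra_simps)
  qed (use normalized(5,6) in simp_all)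
  have LN0: "val (SL n) (SN (- n)) = 0" for n
  proof (rule recursion_LN[where d = "\<lambda>n. val (SL n) (SN (- n))"])
    fix m n
    show "of_int (n - m) * val (SL (m + n)) (SN (- (m + n)))
      = of_int (m + n) * (val (SL n) (SN (- n)) - val (SL m) (SN (- m)))"
      using cocycle_basis[of "SL m" "SL n" "SN (- (m + n))"] by (simp add: evaluate algebra_simps)
  qed (use normalized(7,8) in simp_all)
  \<comment> \<open>This triple gives
    \<open>val (SN n) (SN (- n)) = of_int n * val (SN 1) (SN (-1))\<close> at once, without a
    recursion.\<close>
  have NN0: "val (SN n) (SN (- n)) = 0" for n
    using cocycle_basis[of "SL (n - 1)" "SN 1" "SN (- n)"] normalized(9)
      val_skew[of "SN (-1)" "SN 1"]
    by (simp add: evaluate algebra_simps)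
  have L: "val (SL m) (SL n) = 0" and LN: "val (SL m) (SN n) = 0" and N: "val (SN m) (SN n) = 0" for m n
    using LL' LL0[of m] LN' LN0[of m] NN' NN0[of m] by (cases "m + n = 0"; simp add: add_eq_0_iff)+
  have "val i j = 0"
    by (cases i; cases j) (simp_all add: L LM LN LY N NM' NY' MM MY YY orient)
  then show ?thesis by (simp add: val_def)
qed

lemma (in sv_cocycle) zero_if_zero_on_basis:
  assumes "\<And>i j. \<beta> (basis i) (basis j) = 0"
  shows "\<beta> x y = 0"
proof (induction x rule: pm_basis_induct)
  case (basis i)
  show ?case
    by (induction y rule: pm_basis_induct) (simp_all add: assms add scale)
qed (simp_all add: add scale)

section \<open>Factoring cocycles through the bracket of \<open>svh\<close>\<close>

lemma sv_cocycle_diff: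
  assumes "sv_cocycle \<alpha>" "sv_cocycle \<gamma>"
  shows "sv_cocycle (\<lambda>x y. \<alpha> x y - \<gamma> x y)"
proof -
  interpret a: sv_cocycle \<alpha> by fact
  interpret c: sv_cocycle \<gamma> by fact
  show ?thesis
  proof
    fix x y z
    show "\<alpha> y x - \<gamma> y x = - (\<alpha> x y - \<gamma> x y)"
      using a.skew[of x y] c.skew[of x y] by simp
    show "\<alpha> (sv_bracket x y) z - \<gamma> (sv_bracket x y) z + (\<alpha> (sv_bracket y z) x - \<gamma> (sv_bracket y z) x)
      + (\<alpha> (sv_bracket z x) y - \<gamma> (sv_bracket z x) y) = 0"
      using arg_cong2[OF a.cocycle[of x y z] c.cocycle[of x y z], of "(-)"] by (simp add: algebra_simps)
  qed (simp_all add: a.add a.scale c.add c.scale algebra_simps)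
qed

lemma svh_bracket_skew: "svh_bracket y x = - svh_bracket x y"
  using svh.bracket_self[of "x + y"] unfolding svh_bracket_bilin
  by (intro minus_unique[symmetric]) (simp add: svh.bracket_self add.commute)

text \<open>This is the Jacobi identity of \<open>svh\<close> under \<phi>. With \<open>f\<close>
  the identity it gives the cocycle subtracted for normalization; with \<phi> a central coordinate,
  the central terms to be matched when \<open>f\<close> is lifted.\<close>

lemma sv_cocycle_svh_bracket:
  assumes f: "pm_linear f" "\<And>x y. f (sv_bracket x y) = sv_bracket (f x) (f y)"
    and add: "\<And>x y. \<phi> (x + y) = \<phi> x + \<phi> y" and scale: "\<And>c x. \<phi> (pm_scale c x) = c * \<phi> x"
  shows "sv_cocycle (\<lambda>x y. \<phi> (svh_bracket (svh_incl (f x)) (svh_incl (f y))))"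
proof
  have uminus: "\<phi> (- x) = - \<phi> x" for x
    using scale[of 0 0] add[of x "- x"] by (simp add: eq_neg_iff_add_eq_0 add.commute)
  fix x y z
  show "\<phi> (svh_bracket (svh_incl (f y)) (svh_incl (f x)))
    = - \<phi> (svh_bracket (svh_incl (f x)) (svh_incl (f y)))"
    by (subst svh_bracket_skew) (rule uminus)
  \<comment> \<open>\<open>svh_incl (f (sv_bracket x y))\<close> and
    \<open>svh_bracket (svh_incl (f x)) (svh_incl (f y))\<close> have the same projection, hence the
    same brackets.\<close>
  have br: "svh_bracket (svh_incl (f (sv_bracket x y))) (svh_incl (f z))
    = - svh_bracket (svh_incl (f z)) (svh_bracket (svh_incl (f x)) (svh_incl (f y)))" for x y z
    by (subst svh_bracket_skew, subst neg_equal_iff_equal, rule svh_bracket_cong)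
       (simp_all add: f(2) svh_proj_bracket)
  have J: "\<phi> (svh_bracket (svh_incl (f x)) (svh_bracket (svh_incl (f y)) (svh_incl (f z))))
    + \<phi> (svh_bracket (svh_incl (f y)) (svh_bracket (svh_incl (f z)) (svh_incl (f x))))
    + \<phi> (svh_bracket (svh_incl (f z)) (svh_bracket (svh_incl (f x)) (svh_incl (f y)))) = 0"
    using scale[of 0 0] by (simp only: svh.jacobi flip: add) simp
  have negate: "- c + - a + - b = - (a + b + c)" for a b c :: complex
    by simp
  show "\<phi> (svh_bracket (svh_incl (f (sv_bracket x y))) (svh_incl (f z)))
    + \<phi> (svh_bracket (svh_incl (f (sv_bracket y z))) (svh_incl (f x)))
    + \<phi> (svh_bracket (svh_incl (f (sv_bracket z x))) (svh_incl (f y))) = 0"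
    unfolding br uminus negate J by simp
qed (simp_all add: pm_linearD[OF f(1)] svh_bracket_bilin add scale)

text \<open>Universality of the extension in dual form: \<phi> is chosen so that the difference of
  the two cocycles is normalized, hence zero.\<close>

lemma sv_cocycle_factors:
  assumes "sv_cocycle \<alpha>"
  obtains \<phi> where "\<And>x y. \<phi> (x + y) = \<phi> x + \<phi> y" "\<And>c x. \<phi> (pm_scale c x) = c * \<phi> x"
    "\<And>x y. \<phi> (svh_bracket x y) = \<alpha> (svh_proj x) (svh_proj y)"
proof -
  \<comment> \<open>solves \<open>\<phi> [x, y] = \<alpha> x y\<close> for the pairs of basis vectors in \<open>normalized_vanishes_on_basis\<close>\<close>
  define F where "F i = (case i of
      HL n \<Rightarrow> if n = 0 then - \<alpha> (basis (SL 1)) (basis (SL (-1))) / 2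
        else \<alpha> (basis (SL 0)) (basis (SL n)) / of_int n
    | HN n \<Rightarrow> if n = 0 then - \<alpha> (basis (SL 1)) (basis (SN (-1)))
        else \<alpha> (basis (SL 0)) (basis (SN n)) / of_int n
    | HM n \<Rightarrow> \<alpha> (basis (SN 0)) (basis (SM n)) / 2
    | HY n \<Rightarrow> \<alpha> (basis (SN 0)) (basis (SY n))
    | CL \<Rightarrow> 2 * \<alpha> (basis (SL 2)) (basis (SL (-2))) - 4 * \<alpha> (basis (SL 1)) (basis (SL (-1)))
    | CLN \<Rightarrow> (\<alpha> (basis (SL (-1))) (basis (SN 1)) + \<alpha> (basis (SL 1)) (basis (SN (-1)))) / 2
    | CN \<Rightarrow> - \<alpha> (basis (SN 1)) (basis (SN (-1))))" for i
  \<comment> \<open>\<open>lin_ext\<close> takes values in coefficient functions; over the one-point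
    index type these are the scalars.\<close>
  define \<phi> where "\<phi> x = Poly_Mapping.lookup (lin_ext (\<lambda>i. Poly_Mapping.single () (F i)) x) ()" for x
  have \<phi>: "\<phi> (x + y) = \<phi> x + \<phi> y" "\<phi> (pm_scale c x) = c * \<phi> x" "\<phi> (Poly_Mapping.single i c) = c * F i" "\<phi> 0 = 0"
    for x y c i
    by (simp_all add: \<phi>_def lookup_add)
  interpret b: sv_cocycle "\<lambda>x y. \<alpha> x y - \<phi> (svh_bracket (svh_incl x) (svh_incl y))"
    by (intro sv_cocycle_diff assms sv_cocycle_svh_bracket[where f = "\<lambda>x. x"] pm.linear_ident \<phi>) simp
  have "\<alpha> x y - \<phi> (svh_bracket (svh_incl x) (svh_incl y)) = 0" for x y
    by (rule b.zero_if_zero_on_basis, rule b.normalized_vanishes_on_basis) (simp_all add: \<phi> F_def field_simps)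
  then have "\<phi> (svh_bracket x y) = \<alpha> (svh_proj x) (svh_proj y)" for x y
    using svh_bracket_proj[of x y] by simp
  with \<phi> that show thesis by blast
qed


section \<open>Lifting and descending automorphisms\<close>

abbreviation "Aut_sv \<equiv> carrier (lie_aut pm_scale sv_bracket)"
abbreviation "Aut_svh \<equiv> carrier (lie_aut pm_scale svh_bracket)"

lemma lie_aut_iff:
  "f \<in> carrier (lie_aut scale bracket) \<longleftrightarrow> Vector_Spaces.linear scale scale f \<and> bij f \<and>
    (\<forall>x y. f (bracket x y) = bracket (f x) (f y))"
  by (simp add: lie_aut_def)

lemma lie_aut_simps:
  "x \<otimes>\<^bsub>lie_aut scale bracket\<^esub> y = x \<circ> y" "\<one>\<^bsub>lie_aut scale bracket\<^esub> = id"
  by (simp_all add: lie_aut_def)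

text \<open>The naive lift \<open>svh_incl (f (svh_proj x))\<close> misses the central terms of
  brackets. These are the central coordinates of \<omega>, which are cocycles, hence linear
  functions \<open>p\<close>, \<open>q\<close>, \<open>r\<close> of the bracket, and are added as a
  correction.\<close>

lemma sv_hom_lift:
  assumes f: "pm_linear f" "\<And>x y. f (sv_bracket x y) = sv_bracket (f x) (f y)"
  obtains g where "pm_linear g" "\<And>x y. g (svh_bracket x y) = svh_bracket (g x) (g y)"
    "\<And>x. svh_proj (g x) = f (svh_proj x)"
proof -
  define \<omega> where "\<omega> x y = svh_bracket (svh_incl (f x)) (svh_incl (f y))" for x y
  have cocycle: "sv_cocycle (\<lambda>x y. Poly_Mapping.lookup (\<omega> x y) c)" for c
    unfolding \<omega>_def by (intro sv_cocycle_svh_bracket f) (simp_all add: lookup_add)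
  obtain p where p: "\<And>x y. p (x + y) = p x + p y" "\<And>c x. p (pm_scale c x) = c * p x"
    "\<And>x y. p (svh_bracket x y) = Poly_Mapping.lookup (\<omega> (svh_proj x) (svh_proj y)) CL"
    using sv_cocycle_factors[OF cocycle] by blast
  obtain q where q: "\<And>x y. q (x + y) = q x + q y" "\<And>c x. q (pm_scale c x) = c * q x"
    "\<And>x y. q (svh_bracket x y) = Poly_Mapping.lookup (\<omega> (svh_proj x) (svh_proj y)) CLN"
    using sv_cocycle_factors[OF cocycle] by blast
  obtain r where r: "\<And>x y. r (x + y) = r x + r y" "\<And>c x. r (pm_scale c x) = c * r x"
    "\<And>x y. r (svh_bracket x y) = Poly_Mapping.lookup (\<omega> (svh_proj x) (svh_proj y)) CN"
    using sv_cocycle_factors[OF cocycle] by blast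
  define g where "g x = svh_incl (f (svh_proj x)) + pm_scale (p x) (basis CL)
    + pm_scale (q x) (basis CLN) + pm_scale (r x) (basis CN)" for x
  have proj: "svh_proj (g x) = f (svh_proj x)" for x
    by (simp add: g_def)
  have "pm_linear g"
    by (rule pm_linearI)
       (simp_all add: g_def p q r pm_linearD[OF f(1)] pm.scale_left_distrib pm.scale_right_distrib add_ac
         del: pm_scale_single)
  moreover have "g (svh_bracket x y) = svh_bracket (g x) (g y)" for x y
  proof -
    \<comment> \<open>Both sides have the same projection and central coordinates, which determine a
      vector by \<open>svh_decompose\<close>.\<close>
    have "g (svh_bracket x y) = \<omega> (svh_proj x) (svh_proj y)"
      by (subst (2) svh_decompose) (simp add: g_def p q r \<omega>_def svh_proj_bracket f(2))
    also have "\<dots> = svh_bracket (g x) (g y)"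
      unfolding \<omega>_def by (rule svh_bracket_cong) (simp_all add: proj)
    finally show ?thesis .
  qed
  ultimately show thesis using proj that by blast
qed

lemma lie_aut_inverse:
  assumes "lie_algebra pm_scale bracket" "f \<in> carrier (lie_aut pm_scale bracket)"
  obtains g where "g \<in> carrier (lie_aut pm_scale bracket)" "\<And>x. g (f x) = x" "\<And>x. f (g x) = x"
proof -
  interpret lie_algebra pm_scale bracket by fact
  interpret group "lie_aut pm_scale bracket" by (rule group_lie_aut)
  show thesis
    using that[OF inv_closed[OF assms(2)]] l_inv[OF assms(2)] r_inv[OF assms(2)]
    by (auto simp: lie_aut_simps fun_eq_iff)
qed

text \<open>Lifts of \<open>f\<close> and of its inverse compose to lifts of the identity, which
  equal the identity by uniqueness.\<close>

lemma sv_aut_lift: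
  assumes "f \<in> Aut_sv"
  obtains g where "g \<in> Aut_svh" "\<And>x. svh_proj (g x) = f (svh_proj x)"
proof -
  obtain f' where f': "f' \<in> Aut_sv" "\<And>x. f' (f x) = x" "\<And>x. f (f' x) = x"
    using lie_aut_inverse[OF lie_algebra_sv assms] by blast
  obtain g where g: "pm_linear g" "\<And>x y. g (svh_bracket x y) = svh_bracket (g x) (g y)"
    "\<And>x. svh_proj (g x) = f (svh_proj x)"
    by (rule sv_hom_lift[of f]) (use assms in \<open>auto simp: lie_aut_iff\<close>)
  obtain g' where g': "pm_linear g'" "\<And>x y. g' (svh_bracket x y) = svh_bracket (g' x) (g' y)"
    "\<And>x. svh_proj (g' x) = f' (svh_proj x)"
    by (rule sv_hom_lift[of f']) (use f'(1) in \<open>auto simp: lie_aut_iff\<close>)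
  have "g \<circ> g' = id" "g' \<circ> g = id"
    by (rule svh_hom_unique;
        simp add: g g' f' pm.linear_id Vector_Spaces.linear_compose[OF g'(1) g(1)]
          Vector_Spaces.linear_compose[OF g(1) g'(1)])+
  then have "bij g" by (metis o_bij)
  with g have "g \<in> Aut_svh" by (simp add: lie_aut_iff)
  then show thesis using g(3) by (rule that)
qed

section \<open>Descent along the projection\<close>

definition svh_descend ::
    "((svh_index \<Rightarrow>\<^sub>0 complex) \<Rightarrow> (svh_index \<Rightarrow>\<^sub>0 complex)) \<Rightarrow> (sv_index \<Rightarrow>\<^sub>0 complex) \<Rightarrow> (sv_index \<Rightarrow>\<^sub>0 complex)"
  where "svh_descend g x = svh_proj (g (svh_incl x))"

text \<open>Descent does not depend on the section: \<open>g\<close> is surjective, so it sends the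
  central vector \<open>z\<close> to a central one, whose projection commutes with all of
  \<open>sv\<close> and is therefore zero.\<close>

lemma svh_descend_proj:
  assumes "g \<in> Aut_svh"
  shows "svh_descend g (svh_proj x) = svh_proj (g x)"
proof -
  have lin: "pm_linear g" and bij: "bij g" and br: "\<And>x y. g (svh_bracket x y) = svh_bracket (g x) (g y)"
    using assms by (auto simp: lie_aut_iff)
  define z where "z = svh_incl (svh_proj x) - x"
  have central: "svh_bracket z y = 0" for y
    using svh_bracket_cong[of z 0 y y] by (simp add: z_def svh_bracket_def)
  have "sv_bracket (svh_proj (g z)) y = 0" for y
  proof -
    obtain w where "g w = svh_incl y" using bij by (metis bij_pointE)
    then have "svh_bracket (g z) (svh_incl y) = 0"
      using br[of z w] central by (simp add: pm_linearD[OF lin])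
    then show ?thesis using svh_proj_bracket[of "g z" "svh_incl y"] by simp
  qed
  then have "svh_proj (g z) = 0" by (rule sv_centerless)
  then show ?thesis by (simp add: svh_descend_def z_def pm_linearD[OF lin])
qed

lemma svh_descend_comp:
  assumes "g \<in> Aut_svh"
  shows "svh_descend (g \<circ> h) = svh_descend g \<circ> svh_descend h"
  by (simp add: fun_eq_iff svh_descend_def[of h] svh_descend_def[of "g \<circ> h"] svh_descend_proj[OF assms])

lemma svh_descend_aut:
  assumes g: "g \<in> Aut_svh"
  shows "svh_descend g \<in> Aut_sv"
proof -
  obtain g' where g': "g' \<in> Aut_svh" "g' \<circ> g = id" "g \<circ> g' = id"
    using lie_aut_inverse[OF lie_algebra_svh g] by (metis eq_id_iff comp_apply)
  have "svh_descend id = id" by (simp add: fun_eq_iff svh_descend_def)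
  then have "bij (svh_descend g)"
    using g g' svh_descend_comp by (metis o_bij)
  moreover have "pm_linear (svh_descend g)"
    by (rule pm_linearI) (use g in \<open>simp_all add: svh_descend_def lie_aut_iff pm_linearD\<close>)
  moreover have "svh_descend g (sv_bracket x y) = sv_bracket (svh_descend g x) (svh_descend g y)" for x y
    using svh_descend_proj[OF g, of "svh_bracket (svh_incl x) (svh_incl y)"] g
    by (simp add: svh_proj_bracket lie_aut_iff svh_descend_def)
  ultimately show ?thesis by (simp add: lie_aut_iff)
qed

theorem theorem5p10:
  shows "lie_aut pm_scale sv_bracket \<cong> lie_aut pm_scale svh_bracket"
proof -
  have "inj_on svh_descend Aut_svh"
  proof (rule inj_onI)
    fix g h assume gh: "g \<in> Aut_svh" "h \<in> Aut_svh" "svh_descend g = svh_descend h"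
    show "g = h"
    proof (rule svh_hom_unique)
      show "svh_proj (g x) = svh_proj (h x)" for x
        using gh svh_descend_proj by metis
    qed (use gh in \<open>auto simp: lie_aut_iff\<close>)
  qed
  moreover have "f \<in> svh_descend ` Aut_svh" if f: "f \<in> Aut_sv" for f
  proof -
    obtain g where g: "g \<in> Aut_svh" "\<And>x. svh_proj (g x) = f (svh_proj x)"
      using sv_aut_lift[OF f] by blast
    then have "f = svh_descend g" by (simp add: fun_eq_iff svh_descend_def)
    with g show ?thesis by blast
  qed
  ultimately have "bij_betw svh_descend Aut_svh Aut_sv"
    using svh_descend_aut by (auto simp: bij_betw_def)
  then have "svh_descend \<in> iso (lie_aut pm_scale svh_bracket) (lie_aut pm_scale sv_bracket)"
    by (auto simp: iso_def hom_def lie_aut_simps svh_descend_aut svh_descend_comp)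
  \<comment> \<open>The isomorphism built runs from \<open>svh\<close> to \<open>sv\<close>, so it
    is reversed.\<close>
  then show ?thesis
    using group.iso_sym[OF svh.group_lie_aut] by (auto simp: is_iso_def)
qed

end
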